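(* Let $\Sigma=(X,\mathcal{U},\phi)$ be a control system and let $\mathcal{A}\subset X$ be a nonempty bounded set. Then $\Sigma$ is CUAG with respect to $\mathcal{A}$ if and only if $\Sigma$ is BRS and UAG with respect to $\mathcal{A}$.
   Context: Notation: $\mathbb{R}_+=[0,\infty)$. For a nonempty subset $\mathcal{A}$ of a normed space $(X,\|\cdot\|)$, $\|x\|_{\mathcal{A}}:=\inf_{y\in\mathcal{A}}\|x-y\|$; $B_r(\mathcal{A})=\{x\in X:\|x\|_{\mathcal{A}}<r\}$, and $\overline{B_r(\mathcal{A})}$ is its closure. $\mathcal{K}$: continuous strictly increasing $\gamma:\mathbb{R}_+\to\mathbb{R}_+$ with $\gamma(0)=0$; $\mathcal{K}_\infty$: unbounded elements of $\mathcal{K}$; $\mathcal{L}$: continuous strictly decreasing $\gamma:\mathbb{R}_+\to\mathbb{R}_+$ with $\lim_{t\to\infty}\gamma(t)=0$; $\mathcal{KL}$: continuous $\beta:\mathbb{R}_+\times\mathbb{R}_+\to\mathbb{R}_+$ with $\beta(\cdot,t)\in\mathcal{K}$ for all $t\ge0$ and $\beta(r,\cdot)\in\mathcal{L}$ for all $r>0$. Control system: a triple $\Sigma=(X,\mathcal{U},\phi)$ where $(X,\|\cdot\|)$ is a normed linear space (state space); $\mathcal{U}\subset\{f:\mathbb{R}_+\to U\}$, with $U$ a nonempty subset of a normed linear space, is a space of inputs with $0\in\mathcal{U}$, endowed with a norm $\|\cdot\|_{\mathcal{U}}$, satisfying: (shift invariance) for all $u\in\mathcal{U}$, $\tau\ge0$: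 $u(\cdot+\tau)\in\mathcal{U}$ and $\|u(\cdot+\tau)\|_{\mathcal{U}}\le\|u\|_{\mathcal{U}}$; (concatenation) for all $u_1,u_2\in\mathcal{U}$, $t>0$ the function $u$ with $u(\tau)=u_1(\tau)$ for $\tau\in[0,t]$ and $u(\tau)=u_2(\tau-t)$ for $\tau>t$ belongs to $\mathcal{U}$, and if $u_2\equiv0$ then $\|u\|_{\mathcal{U}}\le\|u_1\|_{\mathcal{U}}$; and $\phi:\mathbb{R}_+\times X\times\mathcal{U}\to X$ is a map (defined for all $(t,x,u)$) with: $\phi(0,x,u)=x$; (causality) if $u,\tilde u\in\mathcal{U}$ and $u(s)=\tilde u(s)$ for all $s\in[0,t]$ then $\phi(t,x,u)=\phi(t,x,\tilde u)$; (continuity) $t\mapsto\phi(t,x,u)$ is continuous for each $(x,u)$; (cocycle) $\phi(h,\phi(t,x,u),u(t+\cdot))=\phi(t+h,x,u)$ for all $t,h\ge0$, $x\in X$, $u\in\mathcal{U}$. BRS (bounded reachability sets): for all $C>0$, $\tau>0$: $\sup\{\|\phi(t,x,u)\|:\|x\|\le C,\|u\|_{\mathcal{U}}\le C,t\in[0,\tau]\}<\infty$. UAG w.r.t. $\mathcal{A}$: there is $\gamma\in\mathcal{K}_\infty$ such that for all $\varepsilon,r>0$ there is $\tau=\tau(\varepsilon,r)<\infty$ such that for all $u\in\mathcal{U}$, all $x\in\overline{B_r(\mathcal{A})}$ and all $t\ge\tau$: $\|\phi(t,x,u)\|_{\mathcal{A}}\le\varepsilon+\gamma(\|u\|_{\mathcal{U}})$.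 CUAG w.r.t. $\mathcal{A}$: there are $\beta\in\mathcal{KL}$, $\gamma\in\mathcal{K}_\infty$, $C>0$ such that $\|\phi(t,x,u)\|_{\mathcal{A}}\le\beta(\|x\|_{\mathcal{A}}+C,t)+\gamma(\|u\|_{\mathcal{U}})$ for all $x\in X,u\in\mathcal{U},t\ge0$. *)

theory Defs
  imports "HOL-Analysis.Analysis"
begin

section \<open>Comparison functions\<close>

text \<open>Functions on \<open>[0,\<infinity>)\<close> are represented by functions on the reals of which only the values on
  \<open>{0..}\<close> are constrained or used.\<close>

definition class_K :: "(real \<Rightarrow> real) set" where
  "class_K = {\<gamma>. \<gamma> \<in> {0..} \<rightarrow> {0..} \<and> continuous_on {0..} \<gamma> \<and> strict_mono_on {0..} \<gamma> \<and> \<gamma> 0 = 0}"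

definition class_K_inf :: "(real \<Rightarrow> real) set" where
  "class_K_inf = {\<gamma> \<in> class_K. \<not> bdd_above (\<gamma> ` {0..})}"

definition class_L :: "(real \<Rightarrow> real) set" where
  "class_L = {\<gamma>. \<gamma> \<in> {0..} \<rightarrow> {0..} \<and> continuous_on {0..} \<gamma> \<and> strict_antimono_on {0..} \<gamma> \<and>
     (\<gamma> \<longlongrightarrow> 0) at_top}"

definition class_KL :: "(real \<Rightarrow> real \<Rightarrow> real) set" where
  "class_KL = {\<beta>. continuous_on ({0..} \<times> {0..}) (\<lambda>(r, t). \<beta> r t) \<and>
     (\<forall>t\<ge>0. (\<lambda>r. \<beta> r t) \<in> class_K) \<and> (\<forall>r>0. \<beta> r \<in> class_L)}"

section \<open>Inputs\<close>

text \<open>An input is a function on \<open>{0..}\<close>, represented extensionally (\<^const>\<open>undefined\<close> at negative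
  times), so that equality of inputs is equality of functions on \<open>[0,\<infinity>)\<close>.\<close>

definition zero_input :: "real \<Rightarrow> 'v::zero" where
  "zero_input = (\<lambda>t\<in>{0..}. 0)"

definition shift_input :: "real \<Rightarrow> (real \<Rightarrow> 'v) \<Rightarrow> real \<Rightarrow> 'v" where
  "shift_input \<tau> u = (\<lambda>t\<in>{0..}. u (t + \<tau>))"

definition concat_input :: "real \<Rightarrow> (real \<Rightarrow> 'v) \<Rightarrow> (real \<Rightarrow> 'v) \<Rightarrow> real \<Rightarrow> 'v" where
  "concat_input t u\<^sub>1 u\<^sub>2 = (\<lambda>\<tau>\<in>{0..}. if \<tau> \<le> t then u\<^sub>1 \<tau> else u\<^sub>2 (\<tau> - t))"

text \<open>The values of inputs lie in an arbitrary subset of a normed space, so a space of inputs need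
  not be a linear space. The norm axioms are therefore required whenever the sums and multiples
  involved are inputs again; for a linear space of inputs, these are the usual axioms of a norm.\<close>

definition norm_on_inputs ::
    "(real \<Rightarrow> 'v::real_vector) set \<Rightarrow> ((real \<Rightarrow> 'v) \<Rightarrow> real) \<Rightarrow> bool" where
  "norm_on_inputs \<U> N \<longleftrightarrow>
     (\<forall>u\<in>\<U>. N u \<ge> 0) \<and>
     (\<forall>u\<in>\<U>. N u = 0 \<longleftrightarrow> u = zero_input) \<and>
     (\<forall>u\<in>\<U>. \<forall>a. (\<lambda>t\<in>{0..}. a *\<^sub>R u t) \<in> \<U> \<longrightarrow> N (\<lambda>t\<in>{0..}. a *\<^sub>R u t) = \<bar>a\<bar> * N u) \<and>
     (\<forall>u\<in>\<U>. \<forall>v\<in>\<U>. (\<lambda>t\<in>{0..}. u t + v t) \<in> \<U> \<longrightarrow> N (\<lambda>t\<in>{0..}. u t + v t) \<le> N u + N v)"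

section \<open>Control systems\<close>

text \<open>The state space is the type \<open>'x\<close>. The parameters are the set \<open>U\<close> of input values, the space
  \<open>\<U>\<close> of inputs, its norm \<open>N\<close> and the transition map \<open>\<phi>\<close>, which is only relevant at
  nonnegative times and for inputs in \<open>\<U>\<close>.\<close>

locale control_system =
  fixes U :: "'v::real_normed_vector set"
    and \<U> :: "(real \<Rightarrow> 'v) set"
    and N :: "(real \<Rightarrow> 'v) \<Rightarrow> real"
    and \<phi> :: "real \<Rightarrow> 'x::real_normed_vector \<Rightarrow> (real \<Rightarrow> 'v) \<Rightarrow> 'x"
  assumes U_nonempty: "U \<noteq> {}"
    and inputs_subset: "\<U> \<subseteq> {0..} \<rightarrow>\<^sub>E U"
    and zero_input_in: "zero_input \<in> \<U>"
    and norm_inputs: "norm_on_inputs \<U> N"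
    and shift_in: "\<And>u \<tau>. u \<in> \<U> \<Longrightarrow> \<tau> \<ge> 0 \<Longrightarrow> shift_input \<tau> u \<in> \<U>"
    and shift_norm: "\<And>u \<tau>. u \<in> \<U> \<Longrightarrow> \<tau> \<ge> 0 \<Longrightarrow> N (shift_input \<tau> u) \<le> N u"
    and concat_in: "\<And>u\<^sub>1 u\<^sub>2 t. u\<^sub>1 \<in> \<U> \<Longrightarrow> u\<^sub>2 \<in> \<U> \<Longrightarrow> t > 0 \<Longrightarrow> concat_input t u\<^sub>1 u\<^sub>2 \<in> \<U>"
    and concat_norm: "\<And>u t. u \<in> \<U> \<Longrightarrow> t > 0 \<Longrightarrow> N (concat_input t u zero_input) \<le> N u"
    and identity: "\<And>x u. u \<in> \<U> \<Longrightarrow> \<phi> 0 x u = x"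
    and causality: "\<And>t x u v. t \<ge> 0 \<Longrightarrow> u \<in> \<U> \<Longrightarrow> v \<in> \<U> \<Longrightarrow> (\<forall>s\<in>{0..t}. u s = v s) \<Longrightarrow>
      \<phi> t x u = \<phi> t x v"
    and continuity: "\<And>x u. u \<in> \<U> \<Longrightarrow> continuous_on {0..} (\<lambda>t. \<phi> t x u)"
    and cocycle: "\<And>t h x u. t \<ge> 0 \<Longrightarrow> h \<ge> 0 \<Longrightarrow> u \<in> \<U> \<Longrightarrow>
      \<phi> h (\<phi> t x u) (shift_input t u) = \<phi> (t + h) x u"

section \<open>Stability notions\<close>

text \<open>The distance of \<open>x\<close> to a nonempty set \<open>A\<close> is \<^term>\<open>infdist x A\<close>.\<close>

definition ball_around :: "real \<Rightarrow> 'x::metric_space set \<Rightarrow> 'x set" where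
  "ball_around r A = {x. infdist x A < r}"

definition BRS ::
    "(real \<Rightarrow> 'v) set \<Rightarrow> ((real \<Rightarrow> 'v) \<Rightarrow> real) \<Rightarrow>
     (real \<Rightarrow> 'x::real_normed_vector \<Rightarrow> (real \<Rightarrow> 'v) \<Rightarrow> 'x) \<Rightarrow> bool" where
  "BRS \<U> N \<phi> \<longleftrightarrow>
     (\<forall>C>0. \<forall>\<tau>>0. bdd_above {norm (\<phi> t x u) | t x u.
        norm x \<le> C \<and> u \<in> \<U> \<and> N u \<le> C \<and> t \<in> {0..\<tau>}})"

definition UAG ::
    "(real \<Rightarrow> 'v) set \<Rightarrow> ((real \<Rightarrow> 'v) \<Rightarrow> real) \<Rightarrow>
     (real \<Rightarrow> 'x::real_normed_vector \<Rightarrow> (real \<Rightarrow> 'v) \<Rightarrow> 'x) \<Rightarrow> 'x set \<Rightarrow> bool" where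
  "UAG \<U> N \<phi> A \<longleftrightarrow>
     (\<exists>\<gamma>\<in>class_K_inf. \<forall>\<epsilon>>0. \<forall>r>0. \<exists>\<tau>\<ge>0. \<forall>u\<in>\<U>. \<forall>x\<in>closure (ball_around r A). \<forall>t\<ge>\<tau>.
        infdist (\<phi> t x u) A \<le> \<epsilon> + \<gamma> (N u))"

definition CUAG ::
    "(real \<Rightarrow> 'v) set \<Rightarrow> ((real \<Rightarrow> 'v) \<Rightarrow> real) \<Rightarrow>
     (real \<Rightarrow> 'x::real_normed_vector \<Rightarrow> (real \<Rightarrow> 'v) \<Rightarrow> 'x) \<Rightarrow> 'x set \<Rightarrow> bool" where
  "CUAG \<U> N \<phi> A \<longleftrightarrow>
     (\<exists>\<beta>\<in>class_KL. \<exists>\<gamma>\<in>class_K_inf. \<exists>C>0. \<forall>x. \<forall>u\<in>\<U>. \<forall>t\<ge>0.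
        infdist (\<phi> t x u) A \<le> \<beta> (infdist x A + C) t + \<gamma> (N u))"

end

theory Submission imports Defs begin

text \<open>
  For the hard direction, UAG with \<open>\<epsilon> = 1\<close> bounds the trajectories after a time that does not depend
  on the input, and BRS bounds them before that time; measuring the data by the maximum of
  \<open>\<parallel>x\<parallel>\<^sub>A\<close> and \<open>\<parallel>u\<parallel>\<close> and splitting the maximum gives a global bound
  \<open>\<kappa>(\<parallel>x\<parallel>\<^sub>A + 1) + \<kappa>(2) + \<kappa>(2\<parallel>u\<parallel>)\<close>. Adding \<open>\<kappa>(2\<cdot>)\<close> to the UAG gain yields a gain \<open>\<gamma>'\<close> such that,
  for each \<open>n\<close>, the excess of \<open>\<parallel>\<phi>(t,x,u)\<parallel>\<^sub>A\<close> over \<open>\<gamma>'(\<parallel>u\<parallel>)\<close> with \<open>\<parallel>x\<parallel>\<^sub>A \<le> n + 1\<close> is bounded and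
  eventually small, both uniformly in \<open>x\<close> and \<open>u\<close>; hence it lies below some \<open>g\<^sub>n \<in> \<L>\<close>. The functions
  \<open>g\<^sub>n\<close> are glued to a \<open>\<K>\<L>\<close> function by a locally finite sum.
\<close>

section \<open>Majorants of class L\<close>

lemma min_exp_lipschitz:
  fixes s t t' :: real
  shows "min 1 (exp (s - t)) \<le> min 1 (exp (s - t')) + \<bar>t - t'\<bar>"
proof (cases "t' \<le> t")
  case True
  then have "exp (s - t) \<le> exp (s - t')" by simp
  then show ?thesis by linarith
next
  case False
  \<comment> \<open>Truncating the exponent at 0 keeps it where the slope of exp is at most 1, which
    gives the Lipschitz constant 1.\<close>
  define m where "m = min (s - t) 0"
  have 1: "min 1 (exp (s - t)) = exp m"
    unfolding m_def by (auto simp: min_def)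
  have 2: "exp (m - (t' - t)) \<le> min 1 (exp (s - t'))"
    using False unfolding m_def by (auto simp: min_def)
  have 3: "1 - exp (- (t' - t)) \<le> t' - t"
    using exp_ge_add_one_self[of "- (t' - t)"] by linarith
  have 4: "0 \<le> 1 - exp (- (t' - t))" using False by simp
  have "exp m - exp (m - (t' - t)) = exp m * (1 - exp (- (t' - t)))"
    by (simp add: algebra_simps flip: exp_add)
  also have "\<dots> \<le> 1 * (1 - exp (- (t' - t)))"
    using 4 by (intro mult_right_mono) (auto simp: m_def)
  finally have "exp m \<le> exp (m - (t' - t)) + (t' - t)" using 3 by simp
  also have "\<dots> \<le> min 1 (exp (s - t')) + \<bar>t - t'\<bar>"
    using 2 False by (intro add_mono) auto
  finally show ?thesis unfolding 1 .
qed

lemma exp_uminus_tendsto_zero: "((\<lambda>t::real. exp (- t)) \<longlongrightarrow> 0) at_top"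
  by (rule filterlim_compose[OF exp_at_bot filterlim_uminus_at_bot_at_top])

text \<open>A relation replaces a function of time: many trajectories contribute values at the same
  time, and no supremum over states and inputs has to be formed beforehand.\<close>

lemma class_L_majorant:
  fixes P :: "real \<Rightarrow> real \<Rightarrow> bool"
  assumes bound: "\<And>s y. P s y \<Longrightarrow> y \<le> M"
    and tail: "\<And>\<epsilon>. \<epsilon> > 0 \<Longrightarrow> \<exists>\<tau>. \<forall>s y. P s y \<longrightarrow> s \<ge> \<tau> \<longrightarrow> y \<le> \<epsilon>"
  obtains g where "g \<in> class_L" "\<And>s y. P s y \<Longrightarrow> y \<le> g s"
proof -
  \<comment> \<open>The sup-convolution of the points with the Lipschitz kernel \<open>min 1 (exp (s - t))\<close> is
    Lipschitz and decreasing, and a point with small \<open>s\<close> is damped exponentially. The point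
    \<open>(0, 0)\<close> keeps the supremum away from the empty set.\<close>
  define Q where "Q = insert (0, 0) {(s, y). P s y \<and> y \<ge> 0}"
  define M' where "M' = max M 0"
  define k where "k = (\<lambda>t (s, y). y * min 1 (exp (s - t :: real)) :: real)"
  define h where "h = (\<lambda>t. SUP q\<in>Q. k t q)"
  have Q: "Q \<noteq> {}" "(0, 0) \<in> Q" by (auto simp: Q_def)
  have Qb: "0 \<le> y \<and> y \<le> M'" if "(s, y) \<in> Q" for s y
    using that bound by (auto simp: Q_def M'_def le_max_iff_disj)
  have k_le: "k t (s, y) \<le> y" if "(s, y) \<in> Q" for s y t
    using Qb[OF that] by (auto simp: k_def intro: mult_left_le)
  have bdd: "bdd_above (k t ` Q)" for t
    using k_le Qb by (intro bdd_aboveI2[of _ _ M']) (force intro: order_trans)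
  have upper: "k t q \<le> h t" if "q \<in> Q" for t q
    unfolding h_def using that bdd by (rule cSUP_upper)
  have least: "h t \<le> z" if "\<And>s y. (s, y) \<in> Q \<Longrightarrow> k t (s, y) \<le> z" for t z
    unfolding h_def using that Q by (intro cSUP_least) auto
  have h0: "0 \<le> h t" for t
    using upper[OF Q(2), of t] by (simp add: k_def)
  have anti: "h t' \<le> h t" if "t \<le> t'" for t t'
  proof (rule least)
    fix s y assume q: "(s, y) \<in> Q"
    have "exp (s - t') \<le> exp (s - t)" using that by simp
    then have "min 1 (exp (s - t')) \<le> min 1 (exp (s - t))" by linarith
    then have "k t' (s, y) \<le> k t (s, y)"
      using Qb[OF q] by (auto simp: k_def intro: mult_left_mono)
    then show "k t' (s, y) \<le> h t" using upper[OF q, of t] by linarith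
  qed
  have lip1: "h t \<le> h t' + M' * \<bar>t - t'\<bar>" for t t'
  proof (rule least)
    fix s y assume q: "(s, y) \<in> Q"
    have "k t (s, y) \<le> y * (min 1 (exp (s - t')) + \<bar>t - t'\<bar>)"
      unfolding k_def prod.case using Qb[OF q] by (intro mult_left_mono min_exp_lipschitz) auto
    also have "\<dots> = k t' (s, y) + y * \<bar>t - t'\<bar>" by (simp add: k_def algebra_simps)
    also have "\<dots> \<le> h t' + M' * \<bar>t - t'\<bar>"
      using Qb[OF q] upper[OF q] by (intro add_mono mult_right_mono) auto
    finally show "k t (s, y) \<le> h t' + M' * \<bar>t - t'\<bar>" .
  qed
  have "M'-lipschitz_on UNIV h"
  proof (rule lipschitz_onI)
    fix t t' show "dist (h t) (h t') \<le> M' * dist t t'"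
      using lip1[of t t'] lip1[of t' t] by (auto simp: dist_real_def abs_minus_commute)
  qed (simp add: M'_def)
  then have cont: "continuous_on {0..} h"
    by (meson lipschitz_on_continuous_on continuous_on_subset subset_UNIV)
  have lim: "(h \<longlongrightarrow> 0) at_top"
  proof (rule tendstoI)
    fix e :: real assume e: "e > 0"
    obtain \<tau> where \<tau>: "\<And>s y. P s y \<Longrightarrow> s \<ge> \<tau> \<Longrightarrow> y \<le> e / 2"
      using tail[of "e / 2"] e by auto
    define \<tau>' where "\<tau>' = max \<tau> 0"
    have "((\<lambda>t. M' * exp (\<tau>' - t)) \<longlongrightarrow> 0) at_top"
      using tendsto_mult_right_zero[OF exp_uminus_tendsto_zero, of "M' * exp \<tau>'"]
      by (simp add: exp_diff exp_minus field_simps)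
    then have "\<forall>\<^sub>F t in at_top. M' * exp (\<tau>' - t) < e / 2"
      using e by (intro order_tendstoD) auto
    then show "\<forall>\<^sub>F t in at_top. dist (h t) 0 < e"
    proof eventually_elim
      case (elim t)
      have "h t \<le> e / 2"
      proof (rule least)
        fix s y assume q: "(s, y) \<in> Q"
        show "k t (s, y) \<le> e / 2"
        \<comment> \<open>Late points are small by the tail hypothesis; early points are at most
          \<open>M'\<close>, and the kernel damps them as \<open>t\<close> grows.\<close>
        proof (cases "s \<ge> \<tau>'")
          case True
          then have "y \<le> e / 2" using q \<tau>[of s y] e by (auto simp: Q_def \<tau>'_def)
          then show ?thesis using k_le[OF q, of t] by linarith
        next
          case False
          have "k t (s, y) \<le> M' * exp (\<tau>' - t)"
            unfolding k_def prod.case using False Qb[OF q]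
            by (intro mult_mono) (auto simp: min.coboundedI2)
          then show ?thesis using elim by linarith
        qed
      qed
      then show ?case using e h0[of t] by (simp add: dist_real_def)
    qed
  qed
  show thesis
  proof
    \<comment> \<open>\<open>h\<close> is only known to be nonincreasing; the added
      \<open>exp (- t)\<close> makes the decrease strict.\<close>
    have "strict_antimono_on {0..} (\<lambda>t. h t + exp (- t))"
      by (intro monotone_onI) (auto intro!: add_le_less_mono anti)
    then show "(\<lambda>t. h t + exp (- t)) \<in> class_L"
      using h0 cont tendsto_add[OF lim exp_uminus_tendsto_zero]
      by (auto simp: class_L_def intro!: continuous_intros)
  next
    fix s y assume "P s y"
    show "y \<le> h s + exp (- s)"
    proof (cases "y \<ge> 0")
      case True
      then have "(s, y) \<in> Q" using \<open>P s y\<close> by (simp add: Q_def)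
      \<comment> \<open>At \<open>t = s\<close> the kernel equals 1, so \<open>h\<close> lies above
        every point of \<open>Q\<close>.\<close>
      from upper[OF this, of s] have "y \<le> h s" by (simp add: k_def)
      then show ?thesis by (simp add: add_increasing2)
    next
      case False
      then show ?thesis using h0[of s] exp_ge_zero[of "- s"] by linarith
    qed
  qed
qed

lemma class_L_pos:
  assumes "g \<in> class_L" "t \<ge> 0"
  shows "g t > 0"
proof -
  have "g (t + 1) \<ge> 0" "g (t + 1) < g t"
    using assms by (auto simp: class_L_def monotone_on_def Pi_iff)
  then show ?thesis by linarith
qed

section \<open>Gluing class L functions to a KL function by ramps\<close>

definition ramp :: "nat \<Rightarrow> real \<Rightarrow> real" where
  "ramp n r = max 0 (min 1 (r - real n))"

lemma ramp_nonneg: "0 \<le> ramp n r"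
  by (simp add: ramp_def)

lemma ramp_mono: "r \<le> r' \<Longrightarrow> ramp n r \<le> ramp n r'"
  by (auto simp: ramp_def)

text \<open>This is \<open>\<Sum>\<^sub>n ramp n r * g n t\<close> over all \<open>n\<close>: the ramps with \<open>n \<ge> r\<close> vanish.\<close>

definition ramp_sum :: "(nat \<Rightarrow> real \<Rightarrow> real) \<Rightarrow> real \<Rightarrow> real \<Rightarrow> real" where
  "ramp_sum g r t = (\<Sum>n<nat \<lceil>r\<rceil>. ramp n r * g n t)"

text \<open>A number of terms that is independent of \<open>r\<close> lets sums at different
  arguments be compared and continuity in \<open>r\<close> be checked.\<close>

lemma ramp_sum_eq:
  assumes "r \<le> real m"
  shows "ramp_sum g r t = (\<Sum>n<m. ramp n r * g n t)"
  unfolding ramp_sum_def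
proof (rule sum.mono_neutral_left)
  show "{..<nat \<lceil>r\<rceil>} \<subseteq> {..<m}" using assms by (simp add: ceiling_le_iff)
  show "\<forall>i\<in>{..<m} - {..<nat \<lceil>r\<rceil>}. ramp i r * g i t = 0"
  proof
    fix i assume "i \<in> {..<m} - {..<nat \<lceil>r\<rceil>}"
    then have "r \<le> real i" by auto
    then show "ramp i r * g i t = 0" by (simp add: ramp_def)
  qed
qed simp

lemma ramp_sum_KL:
  assumes g: "\<And>n. g n \<in> class_L"
  shows "ramp_sum g \<in> class_KL"
proof -
  have gpos: "g n t > 0" if "t \<ge> 0" for n t
    using class_L_pos[OF g that] .
  have gcont: "continuous_on {0..} (g n)" for n
    using g by (auto simp: class_L_def)
  have cont: "continuous_on ({0..} \<times> {0..}) (\<lambda>(r, t). ramp_sum g r t)"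
    unfolding continuous_on_def
  proof (intro ballI)
    fix p :: "real \<times> real" assume p: "p \<in> {0..} \<times> {0..}"
    \<comment> \<open>Continuity is local: on the open strip \<open>r < m\<close> the sum can be
      written with the fixed number \<open>m\<close> of terms.\<close>
    obtain m :: nat where m: "fst p < real m" using reals_Archimedean2 by blast
    define f where "f = (\<lambda>(r, t). \<Sum>n<m. ramp n r * g n t)"
    have "continuous_on ({0..} \<times> {0..}) f"
      unfolding f_def ramp_def case_prod_unfold
      by (intro continuous_intros continuous_on_compose2[OF gcont]) auto
    then have "(f \<longlongrightarrow> f p) (at p within {0..} \<times> {0..})"
      using p unfolding continuous_on_def by (rule bspec)
    moreover have "f q = (\<lambda>(r, t). ramp_sum g r t) q" if "q \<in> {..<real m} \<times> UNIV" for q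
      using that by (auto simp: f_def ramp_sum_eq[of _ m])
    moreover have "open ({..<real m} \<times> (UNIV :: real set))" "p \<in> {..<real m} \<times> UNIV"
      using m by (auto simp: open_Times mem_Times_iff)
    ultimately show "((\<lambda>(r, t). ramp_sum g r t) \<longlongrightarrow> (\<lambda>(r, t). ramp_sum g r t) p)
        (at p within {0..} \<times> {0..})"
      using Lim_transform_within_open by metis
  qed
  have nonneg: "0 \<le> ramp_sum g r t" if "t \<ge> 0" for r t
    unfolding ramp_sum_def
    by (intro sum_nonneg mult_nonneg_nonneg ramp_nonneg less_imp_le[OF gpos[OF that]])
  have mono: "ramp_sum g r t < ramp_sum g r' t" if "0 \<le> r" "r < r'" "t \<ge> 0" for r r' t
  proof -
    define m where "m = nat \<lceil>r'\<rceil>"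
    have m: "r' \<le> real m" "r \<le> real m" using that by (auto simp: m_def) linarith+
    \<comment> \<open>This index picks the ramp that is still rising at \<open>r\<close>; its
      positive factor \<open>g i t\<close> makes the increase strict.\<close>
    define i where "i = nat \<lfloor>r\<rfloor>"
    have i: "real i \<le> r" "r < real i + 1" using that by (auto simp: i_def)
    then have "i < m" using m that by linarith
    have "ramp i r < ramp i r'" using i that by (auto simp: ramp_def)
    then have "(\<Sum>n<m. ramp n r * g n t) < (\<Sum>n<m. ramp n r' * g n t)"
    proof (intro sum_strict_mono_ex1 ballI bexI)
      show "ramp n r * g n t \<le> ramp n r' * g n t" for n
        using that gpos[of t n] by (intro mult_right_mono ramp_mono) auto
      show "ramp i r * g i t < ramp i r' * g i t"
        using \<open>ramp i r < ramp i r'\<close> gpos[OF that(3), of i] by (rule mult_strict_right_mono)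
    qed (use \<open>i < m\<close> in auto)
    then show ?thesis using ramp_sum_eq[OF m(1)] ramp_sum_eq[OF m(2)] by simp
  qed
  have anti: "ramp_sum g r t' < ramp_sum g r t" if "0 < r" "0 \<le> t" "t < t'" for r t t'
  proof -
    have less: "g n t' < g n t" for n
      using g[of n] that by (auto simp: class_L_def monotone_on_def)
    \<comment> \<open>For \<open>r > 0\<close> the ramp of index 0 is positive, so its term
      decreases strictly; other terms may have weight 0.\<close>
    have "0 < nat \<lceil>r\<rceil>" "0 < ramp 0 r" using that by (auto simp: ramp_def)
    show ?thesis unfolding ramp_sum_def
    proof (intro sum_strict_mono_ex1 ballI bexI)
      show "ramp n r * g n t' \<le> ramp n r * g n t" for n
        using less[of n] by (intro mult_left_mono ramp_nonneg) auto
      show "ramp 0 r * g 0 t' < ramp 0 r * g 0 t"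
        using less[of 0] \<open>0 < ramp 0 r\<close> by (rule mult_strict_left_mono)
    qed (use \<open>0 < nat \<lceil>r\<rceil>\<close> in auto)
  qed
  have lim: "(ramp_sum g r \<longlongrightarrow> 0) at_top" for r
  proof -
    have "((\<lambda>t. \<Sum>n<nat \<lceil>r\<rceil>. ramp n r * g n t) \<longlongrightarrow> (\<Sum>n<nat \<lceil>r\<rceil>. ramp n r * 0)) at_top"
      using g by (intro tendsto_intros) (auto simp: class_L_def)
    then show ?thesis by (simp add: ramp_sum_def[abs_def])
  qed
  have c1: "continuous_on {0..} (\<lambda>r. ramp_sum g r t)" if "t \<ge> 0" for t
  proof -
    have "continuous_on {0..} (\<lambda>r. (r, t))" by (intro continuous_intros)
    from continuous_on_compose2[OF cont this] that show ?thesis by auto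
  qed
  have c2: "continuous_on {0..} (ramp_sum g r)" if "r \<ge> 0" for r
  proof -
    have "continuous_on {0..} (\<lambda>t. (r, t))" by (intro continuous_intros)
    from continuous_on_compose2[OF cont this] that show ?thesis by auto
  qed
  have "(\<lambda>r. ramp_sum g r t) \<in> class_K" if "t \<ge> 0" for t
    unfolding class_K_def mem_Collect_eq
  proof (intro conjI)
    show "strict_mono_on {0..} (\<lambda>r. ramp_sum g r t)"
      by (rule strict_mono_onI) (use mono that in auto)
  qed (use nonneg c1 that in \<open>auto simp: ramp_sum_def[of _ 0]\<close>)
  moreover have "ramp_sum g r \<in> class_L" if "r > 0" for r
    unfolding class_L_def mem_Collect_eq
  proof (intro conjI)
    show "strict_antimono_on {0..} (ramp_sum g r)"
      by (rule monotone_onI) (use anti that in auto)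
  qed (use nonneg c2 lim that in auto)
  ultimately show ?thesis using cont by (simp add: class_KL_def)
qed

text \<open>From \<open>n + 1\<close> on the ramp has reached 1, so the term of index
  \<open>n\<close> enters in full, and the other terms are nonnegative.\<close>

lemma ramp_sum_ge:
  assumes "\<And>n. g n t \<ge> 0" "real n + 1 \<le> r"
  shows "g n t \<le> ramp_sum g r t"
proof -
  have "n < nat \<lceil>r\<rceil>" "ramp n r = 1" using assms by (auto simp: ramp_def) linarith
  then show ?thesis
    unfolding ramp_sum_def using assms(1)
    using member_le_sum[of n "{..<nat \<lceil>r\<rceil>}" "\<lambda>n. ramp n r * g n t"] ramp_nonneg by auto
qed

section \<open>Operations on comparison functions\<close>

lemma class_KL_mono:
  assumes "\<beta> \<in> class_KL" "0 \<le> r" "r \<le> r'" "t \<ge> 0"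
  shows "\<beta> r t \<le> \<beta> r' t"
  using assms by (cases "r = r'") (auto simp: class_KL_def class_K_def strict_mono_on_def less_imp_le)

lemma class_K_mono:
  assumes "\<gamma> \<in> class_K" "0 \<le> r" "r \<le> r'"
  shows "\<gamma> r \<le> \<gamma> r'"
  using assms by (cases "r = r'") (auto simp: class_K_def strict_mono_on_def less_imp_le)

lemma class_K_nonneg: "\<gamma> \<in> class_K \<Longrightarrow> 0 \<le> r \<Longrightarrow> 0 \<le> \<gamma> r"
  by (auto simp: class_K_def)

lemma class_K_inf_K: "\<gamma> \<in> class_K_inf \<Longrightarrow> \<gamma> \<in> class_K"
  by (simp add: class_K_inf_def)

lemma class_K_add: "f \<in> class_K \<Longrightarrow> g \<in> class_K \<Longrightarrow> (\<lambda>r. f r + g r) \<in> class_K"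
  by (auto simp: class_K_def strict_mono_on_def Pi_iff intro!: continuous_on_add add_strict_mono)

lemma class_K_inf_add:
  assumes "f \<in> class_K" "g \<in> class_K_inf"
  shows "(\<lambda>r. f r + g r) \<in> class_K_inf"
proof -
  have "\<not> bdd_above ((\<lambda>r. f r + g r) ` {0..})"
  proof
    assume "bdd_above ((\<lambda>r. f r + g r) ` {0..})"
    then obtain M where "\<And>r. r \<ge> 0 \<Longrightarrow> f r + g r \<le> M" by (auto simp: bdd_above_def)
    then have "g r \<le> M" if "r \<ge> 0" for r
      using class_K_nonneg[OF assms(1) that] that by (smt (verit))
    then have "bdd_above (g ` {0..})" by (intro bdd_aboveI2) auto
    then show False using assms by (simp add: class_K_inf_def)
  qed
  then show ?thesis using assms class_K_add by (auto simp: class_K_inf_def)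
qed

lemma class_K_scale:
  assumes "\<gamma> \<in> class_K" "c > 0"
  shows "(\<lambda>r. \<gamma> (c * r)) \<in> class_K"
proof -
  have "continuous_on {0..} (\<lambda>r. \<gamma> (c * r))"
  proof (rule continuous_on_compose2[of "{0..}" \<gamma>])
    show "continuous_on {0..} \<gamma>" using assms by (simp add: class_K_def)
    show "continuous_on {0..} (\<lambda>r. c * r)" by (intro continuous_intros)
  qed (use assms in auto)
  moreover have "strict_mono_on {0..} (\<lambda>r. \<gamma> (c * r))"
    using assms by (intro strict_mono_onI) (auto simp: class_K_def strict_mono_on_def)
  ultimately show ?thesis
    using assms by (simp add: class_K_def Pi_iff)
qed

text \<open>Turns bounds on balls of integer radius into one function of the radius. The ramp sum
  serves again: each \<sigma> value gets an artificial exponential decay in time, and the result is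
  evaluated at time 0.\<close>

lemma class_K_step_majorant:
  fixes \<sigma> :: "nat \<Rightarrow> real"
  assumes "\<And>n. \<sigma> n > 0"
  obtains \<kappa> where "\<kappa> \<in> class_K" "\<And>n r. real n + 1 \<le> r \<Longrightarrow> \<sigma> n \<le> \<kappa> r"
proof -
  define g where "g = (\<lambda>n t. \<sigma> n * exp (- t))"
  have g: "g n \<in> class_L" for n
    unfolding class_L_def g_def mem_Collect_eq
  proof (intro conjI)
    show "strict_antimono_on {0..} (\<lambda>t. \<sigma> n * exp (- t))"
      using assms[of n] by (intro monotone_onI) simp
    show "((\<lambda>t. \<sigma> n * exp (- t)) \<longlongrightarrow> 0) at_top"
      by (rule tendsto_mult_right_zero[OF exp_uminus_tendsto_zero])
  qed (use assms[of n] in \<open>auto intro!: continuous_intros\<close>)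
  show thesis
  proof
    show "(\<lambda>r. ramp_sum g r 0) \<in> class_K"
      using ramp_sum_KL[OF g] by (simp add: class_KL_def)
    show "\<sigma> n \<le> ramp_sum g r 0" if "real n + 1 \<le> r" for n r
      using ramp_sum_ge[of g 0 n r] that assms by (simp add: g_def less_imp_le)
  qed
qed

section \<open>Distance to a bounded set against the norm\<close>

text \<open>BRS speaks of norms, UAG and CUAG of distances to \<open>A\<close>; for bounded
  \<open>A\<close> the two differ by at most \<open>M\<close>.\<close>

lemma norm_le_infdist:
  assumes "A \<noteq> {}" "\<And>a. a \<in> A \<Longrightarrow> norm a \<le> M"
  shows "norm x \<le> infdist x A + M"
proof -
  have "norm x - M \<le> infdist x A"
    unfolding infdist_notempty[OF assms(1)]
  proof (rule cINF_greatest[OF assms(1)])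
    fix a assume "a \<in> A"
    show "norm x - M \<le> dist x a"
      using assms(2)[OF \<open>a \<in> A\<close>] norm_triangle_ineq2[of x a] by (simp add: dist_norm)
  qed
  then show ?thesis by simp
qed

lemma infdist_le_norm:
  assumes "A \<noteq> {}" "\<And>a. a \<in> A \<Longrightarrow> norm a \<le> M"
  shows "infdist x A \<le> norm x + M"
proof -
  obtain a where "a \<in> A" using assms by auto
  then show ?thesis
    using infdist_le[OF \<open>a \<in> A\<close>, of x] assms(2)[of a] norm_triangle_ineq4[of x a]
    by (simp add: dist_norm)
qed

section \<open>CUAG implies UAG and BRS\<close>

lemma CUAG_imp_UAG:
  assumes "CUAG \<U> N \<phi> A"
  shows "UAG \<U> N \<phi> A"
proof -
  obtain \<beta> \<gamma> C where \<beta>: "\<beta> \<in> class_KL" and \<gamma>: "\<gamma> \<in> class_K_inf" and C: "C > 0"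
    and le: "\<And>x u t. u \<in> \<U> \<Longrightarrow> t \<ge> 0 \<Longrightarrow> infdist (\<phi> t x u) A \<le> \<beta> (infdist x A + C) t + \<gamma> (N u)"
    using assms unfolding CUAG_def by blast
  show ?thesis unfolding UAG_def
  proof (intro bexI[OF _ \<gamma>] allI impI)
    fix \<epsilon> r :: real assume "\<epsilon> > 0" "r > 0"
    then have "(\<beta> (r + C) \<longlongrightarrow> 0) at_top" using \<beta> C by (auto simp: class_KL_def class_L_def)
    then have "\<forall>\<^sub>F t in at_top. \<beta> (r + C) t < \<epsilon>"
      using \<open>\<epsilon> > 0\<close> by (rule order_tendstoD)
    then obtain \<tau> where \<tau>: "\<And>t. t \<ge> \<tau> \<Longrightarrow> \<beta> (r + C) t < \<epsilon>"
      by (auto simp: eventually_at_top_linorder)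
    \<comment> \<open>The CUAG estimate is available only for nonnegative times, and the threshold
      \<tau> may be negative; hence the maximum with 0.\<close>
    have "infdist (\<phi> t x u) A \<le> \<epsilon> + \<gamma> (N u)"
      if u: "u \<in> \<U>" and x: "x \<in> closure (ball_around r A)" and t: "max \<tau> 0 \<le> t" for u x t
    proof -
      \<comment> \<open>The closure of the open ball stays in the closed set where the distance is
        at most \<open>r\<close>, so the argument of \<beta> is at most
        \<open>r + C\<close>.\<close>
      have "closure (ball_around r A) \<subseteq> {x. infdist x A \<le> r}"
        by (intro closure_minimal closed_Collect_le continuous_intros) (auto simp: ball_around_def)
      then have "infdist x A \<le> r" using x by auto
      then have "\<beta> (infdist x A + C) t \<le> \<beta> (r + C) t"
        using t C infdist_nonneg[of x A] by (intro class_KL_mono[OF \<beta>]) auto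
      then show ?thesis using le[OF u, of t x] \<tau>[of t] t by auto
    qed
    then show "\<exists>\<tau>\<ge>0. \<forall>u\<in>\<U>. \<forall>x\<in>closure (ball_around r A). \<forall>t\<ge>\<tau>.
        infdist (\<phi> t x u) A \<le> \<epsilon> + \<gamma> (N u)"
      by (intro exI[of _ "max \<tau> 0"]) auto
  qed
qed

text \<open>Since \<beta> decreases in time, its value at time 0 bounds trajectories at all times,
  so the bound does not depend on the horizon.\<close>

lemma CUAG_imp_BRS:
  assumes N: "\<And>u. u \<in> \<U> \<Longrightarrow> N u \<ge> 0"
    and A: "A \<noteq> {}" "bounded A" and "CUAG \<U> N \<phi> A"
  shows "BRS \<U> N \<phi>"
proof -
  obtain \<beta> \<gamma> C where \<beta>: "\<beta> \<in> class_KL" and \<gamma>: "\<gamma> \<in> class_K_inf" and C: "C > 0"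
    and le: "\<And>x u t. u \<in> \<U> \<Longrightarrow> t \<ge> 0 \<Longrightarrow> infdist (\<phi> t x u) A \<le> \<beta> (infdist x A + C) t + \<gamma> (N u)"
    using assms(4) unfolding CUAG_def by blast
  obtain M where M: "M > 0" "\<And>a. a \<in> A \<Longrightarrow> norm a \<le> M"
    using A by (auto simp: bounded_pos)
  have "norm (\<phi> t x u) \<le> \<beta> (D + M + C) 0 + \<gamma> D + M"
    if "norm x \<le> D" "u \<in> \<U>" "N u \<le> D" "t \<in> {0..\<tau>}" for D \<tau> t x u
  proof -
    have x: "infdist x A \<le> D + M" "0 \<le> infdist x A"
      using infdist_le_norm[OF A(1) M(2), of x] that infdist_nonneg by auto
    have "\<beta> (infdist x A + C) t \<le> \<beta> (infdist x A + C) 0"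
    proof (cases "t = 0")
      case False
      \<comment> \<open>\<open>\<beta> r\<close> is in class L only for \<open>r > 0\<close>; adding
        \<open>C > 0\<close> ensures this also at points of distance 0.\<close>
      have "\<beta> (infdist x A + C) \<in> class_L" using \<beta> C x by (auto simp: class_KL_def)
      then show ?thesis using that False by (auto simp: class_L_def monotone_on_def less_imp_le)
    qed simp
    also have "\<dots> \<le> \<beta> (D + M + C) 0"
      using x C by (intro class_KL_mono[OF \<beta>]) auto
    finally have "infdist (\<phi> t x u) A \<le> \<beta> (D + M + C) 0 + \<gamma> D"
      using le[of u t x] class_K_mono[OF class_K_inf_K[OF \<gamma>] N[OF that(2)] that(3)] that by auto
    then show ?thesis using norm_le_infdist[OF A(1) M(2), of "\<phi> t x u"] by linarith
  qed
  then show ?thesis unfolding BRS_def by (intro allI impI bdd_aboveI) blast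
qed

section \<open>BRS and UAG imply CUAG\<close>

lemma BRS_UAG_imp_CUAG:
  assumes N: "\<And>u. u \<in> \<U> \<Longrightarrow> N u \<ge> 0"
    and A: "A \<noteq> {}" "bounded A" and BRS: "BRS \<U> N \<phi>" and UAG: "UAG \<U> N \<phi> A"
  shows "CUAG \<U> N \<phi> A"
proof -
  obtain M where M: "M > 0" "\<And>a. a \<in> A \<Longrightarrow> norm a \<le> M"
    using A by (auto simp: bounded_pos)
  obtain \<gamma> where \<gamma>: "\<gamma> \<in> class_K_inf"
    and *: "\<And>\<epsilon> r. \<epsilon> > 0 \<Longrightarrow> r > 0 \<Longrightarrow> \<exists>\<tau>\<ge>0. \<forall>u\<in>\<U>. \<forall>x\<in>closure (ball_around r A). \<forall>t\<ge>\<tau>.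
        infdist (\<phi> t x u) A \<le> \<epsilon> + \<gamma> (N u)"
    using UAG unfolding UAG_def by blast
  have attr: "\<exists>\<tau>\<ge>0. \<forall>u\<in>\<U>. \<forall>x t. infdist x A \<le> r \<longrightarrow> t \<ge> \<tau> \<longrightarrow>
      infdist (\<phi> t x u) A \<le> \<epsilon> + \<gamma> (N u)" if "\<epsilon> > 0" "r > 0" for \<epsilon> r
  proof -
    \<comment> \<open>Enlarging the radius by 1 passes from the weak inequality to the strict one of
      the open ball.\<close>
    have "x \<in> closure (ball_around (r + 1) A)" if "infdist x A \<le> r" for x
      using that closure_subset by (force simp: ball_around_def)
    then show ?thesis using *[of \<epsilon> "r + 1"] that by (meson add_pos_pos zero_less_one)
  qed
  have "\<exists>\<sigma>>0. \<forall>x u t. infdist x A \<le> real n + 1 \<longrightarrow> u \<in> \<U> \<longrightarrow> N u \<le> real n + 1 \<longrightarrow> t \<ge> 0 \<longrightarrow>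
      infdist (\<phi> t x u) A \<le> \<sigma>" for n :: nat
  proof -
    obtain \<tau> where \<tau>: "\<tau> \<ge> 0" "\<And>x u t. u \<in> \<U> \<Longrightarrow> infdist x A \<le> real n + 1 \<Longrightarrow> t \<ge> \<tau> \<Longrightarrow>
        infdist (\<phi> t x u) A \<le> 1 + \<gamma> (N u)"
      using attr[of 1 "real n + 1"] by auto
    \<comment> \<open>\<open>D\<close> bounds both the input norm and, through the bound
      \<open>M\<close> on \<open>A\<close>, the norm of the state.\<close>
    define D where "D = real n + 1 + M"
    \<comment> \<open>BRS asks for a positive horizon, but \<tau> may be 0; hence
      \<open>\<tau> + 1\<close>.\<close>
    have "bdd_above {norm (\<phi> t x u) | t x u. norm x \<le> D \<and> u \<in> \<U> \<and> N u \<le> D \<and> t \<in> {0..\<tau> + 1}}"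
      using BRS \<tau> M unfolding BRS_def D_def by (auto simp: add_nonneg_pos)
    then obtain S where S: "\<And>t x u. norm x \<le> D \<Longrightarrow> u \<in> \<U> \<Longrightarrow> N u \<le> D \<Longrightarrow> t \<in> {0..\<tau> + 1} \<Longrightarrow>
        norm (\<phi> t x u) \<le> S"
      unfolding bdd_above_def by blast
    \<comment> \<open>The first entry covers times up to \<tau> by BRS, the second all later times
      by UAG.\<close>
    define \<sigma> where "\<sigma> = max (S + M) (1 + \<gamma> (real n + 1))"
    have "\<sigma> > 0" using class_K_nonneg[OF class_K_inf_K[OF \<gamma>], of "real n + 1"] by (auto simp: \<sigma>_def)
    moreover have "infdist (\<phi> t x u) A \<le> \<sigma>"
      if h: "infdist x A \<le> real n + 1" "u \<in> \<U>" "N u \<le> real n + 1" "t \<ge> 0" for x u t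
    proof (cases "t \<le> \<tau>")
      case True
      have "norm x \<le> D" using norm_le_infdist[OF A(1) M(2), of x] h by (auto simp: D_def)
      then have "norm (\<phi> t x u) \<le> S" using True h M by (intro S) (auto simp: D_def)
      then show ?thesis using infdist_le_norm[OF A(1) M(2), of "\<phi> t x u"] by (auto simp: \<sigma>_def)
    next
      case False
      then show ?thesis
        using \<tau>(2)[of u x t] h class_K_mono[OF class_K_inf_K[OF \<gamma>] N[OF h(2)] h(3)]
        by (auto simp: \<sigma>_def)
    qed
    ultimately show ?thesis by blast
  qed
  then obtain \<sigma> where \<sigma>: "\<And>n. \<sigma> n > 0"
    "\<And>n x u t. infdist x A \<le> real n + 1 \<Longrightarrow> u \<in> \<U> \<Longrightarrow> N u \<le> real n + 1 \<Longrightarrow> t \<ge> 0 \<Longrightarrow>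
      infdist (\<phi> t x u) A \<le> \<sigma> n"
    by metis
  obtain \<kappa> where \<kappa>: "\<kappa> \<in> class_K" "\<And>n r. real n + 1 \<le> r \<Longrightarrow> \<sigma> n \<le> \<kappa> r"
    using class_K_step_majorant[of \<sigma>] \<sigma>(1) by blast
  have glob: "infdist (\<phi> t x u) A \<le> \<kappa> (infdist x A + 1) + (\<kappa> 2 + \<kappa> (2 * N u))"
    if h: "u \<in> \<U>" "t \<ge> 0" for x u t
  proof -
    define r where "r = max (infdist x A) (N u)"
    \<comment> \<open>With \<open>n \<le> r < n + 1\<close> the data lie in the range of
      \<open>\<sigma> n\<close>, and \<kappa> dominates \<open>\<sigma> n\<close> from
      \<open>n + 1 \<le> r + 1\<close> on; this is where the shift by 1 arises.\<close>
    define n where "n = nat \<lfloor>r\<rfloor>"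
    have r: "0 \<le> r" using infdist_nonneg[of x A] by (auto simp: r_def)
    have n: "real n \<le> r" "r < real n + 1" using r by (auto simp: n_def)
    have pos: "0 \<le> \<kappa> (infdist x A + 1)" "0 \<le> \<kappa> (N u + 1)" "0 \<le> \<kappa> 2" "0 \<le> \<kappa> (2 * N u)"
      using N[OF h(1)] infdist_nonneg[of x A] by (auto intro!: class_K_nonneg[OF \<kappa>(1)])
    have "infdist (\<phi> t x u) A \<le> \<sigma> n" using n h by (intro \<sigma>(2)) (auto simp: r_def)
    also have "\<dots> \<le> \<kappa> (r + 1)" using n by (intro \<kappa>(2)) auto
    also have "\<dots> \<le> \<kappa> (infdist x A + 1) + \<kappa> (N u + 1)"
      using pos by (auto simp: r_def max_def)
    \<comment> \<open>A gain must vanish at 0, which \<open>\<kappa> (N u + 1)\<close> does not; the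
      split at \<open>N u = 1\<close> moves the offset into the constant
      \<open>\<kappa> 2\<close>.\<close>
    also have "\<kappa> (N u + 1) \<le> \<kappa> 2 + \<kappa> (2 * N u)"
    proof (cases "N u \<le> 1")
      case True
      then have "\<kappa> (N u + 1) \<le> \<kappa> 2" using N[OF h(1)] by (intro class_K_mono[OF \<kappa>(1)]) auto
      then show ?thesis using pos by simp
    next
      case False
      then have "\<kappa> (N u + 1) \<le> \<kappa> (2 * N u)" by (intro class_K_mono[OF \<kappa>(1)]) auto
      then show ?thesis using pos by simp
    qed
    finally show ?thesis by simp
  qed
  \<comment> \<open>One gain has to absorb the input terms of both the global bound and UAG; it is
    unbounded because \<gamma> is.\<close>
  define \<gamma>' where "\<gamma>' = (\<lambda>r. \<kappa> (2 * r) + \<gamma> r)"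
  have \<gamma>': "\<gamma>' \<in> class_K_inf"
    unfolding \<gamma>'_def by (intro class_K_inf_add class_K_scale \<kappa> \<gamma>) simp
  have ge: "\<kappa> (2 * N u) \<le> \<gamma>' (N u)" "\<gamma> (N u) \<le> \<gamma>' (N u)" if "u \<in> \<U>" for u
    using N[OF that] class_K_nonneg[OF \<kappa>(1), of "2 * N u"]
      class_K_nonneg[OF class_K_inf_K[OF \<gamma>], of "N u"] by (auto simp: \<gamma>'_def)
  have "\<exists>g. g \<in> class_L \<and> (\<forall>x u t. infdist x A \<le> real n + 1 \<longrightarrow> u \<in> \<U> \<longrightarrow> t \<ge> 0 \<longrightarrow>
      infdist (\<phi> t x u) A \<le> g t + \<gamma>' (N u))" for n :: nat
  proof -
    define P where "P = (\<lambda>t y. t \<ge> 0 \<and> (\<exists>x u. infdist x A \<le> real n + 1 \<and> u \<in> \<U> \<and>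
      y = infdist (\<phi> t x u) A - \<gamma>' (N u)))"
    obtain g where g: "g \<in> class_L" "\<And>t y. P t y \<Longrightarrow> y \<le> g t"
    proof (rule class_L_majorant)
      show "y \<le> \<kappa> (real n + 2) + \<kappa> 2" if P: "P t y" for t y
      proof -
        obtain x u where h: "infdist x A \<le> real n + 1" "u \<in> \<U>" "t \<ge> 0"
          and y: "y = infdist (\<phi> t x u) A - \<gamma>' (N u)"
          using P unfolding P_def by blast
        have "\<kappa> (infdist x A + 1) \<le> \<kappa> (real n + 2)"
          using h infdist_nonneg[of x A] by (intro class_K_mono[OF \<kappa>(1)]) auto
        then show ?thesis using glob[of u t x] ge(1)[of u] h y by simp
      qed
      show "\<exists>\<tau>. \<forall>t y. P t y \<longrightarrow> t \<ge> \<tau> \<longrightarrow> y \<le> \<epsilon>" if "\<epsilon> > 0" for \<epsilon>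
      proof -
        \<comment> \<open>The time given by UAG does not depend on \<open>u\<close>, so the tail
          condition holds for inputs of every norm at once.\<close>
        obtain \<tau> where "\<And>x u t. u \<in> \<U> \<Longrightarrow> infdist x A \<le> real n + 1 \<Longrightarrow> t \<ge> \<tau> \<Longrightarrow>
            infdist (\<phi> t x u) A \<le> \<epsilon> + \<gamma> (N u)"
          using attr[of \<epsilon> "real n + 1"] \<open>\<epsilon> > 0\<close> by auto
        then show ?thesis using ge(2) unfolding P_def
          by (intro exI[of _ \<tau>]) (smt (verit))
      qed
    qed blast
    have "infdist (\<phi> t x u) A \<le> g t + \<gamma>' (N u)"
      if "infdist x A \<le> real n + 1" "u \<in> \<U>" "t \<ge> 0" for x u t
    proof -
      have "P t (infdist (\<phi> t x u) A - \<gamma>' (N u))" unfolding P_def using that by blast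
      from g(2)[OF this] show ?thesis by simp
    qed
    then show ?thesis using g(1) by blast
  qed
  then obtain g where g: "\<And>n. g n \<in> class_L"
    "\<And>n x u t. infdist x A \<le> real n + 1 \<Longrightarrow> u \<in> \<U> \<Longrightarrow> t \<ge> 0 \<Longrightarrow>
      infdist (\<phi> t x u) A \<le> g n t + \<gamma>' (N u)"
    by metis
  have "infdist (\<phi> t x u) A \<le> ramp_sum g (infdist x A + 1) t + \<gamma>' (N u)"
    if "u \<in> \<U>" "t \<ge> 0" for x u t
  proof -
    \<comment> \<open>The distance is at most \<open>n + 1\<close>, so \<open>g n\<close> applies;
      adding 1 to the distance reaches \<open>n + 1\<close>, where the ramp of index
      \<open>n\<close> is saturated. Hence the choice \<open>C = 1\<close>.\<close>
    define n where "n = nat \<lfloor>infdist x A\<rfloor>"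
    have n: "real n \<le> infdist x A" "infdist x A \<le> real n + 1"
      using infdist_nonneg[of x A] by (auto simp: n_def)
    have "g n t \<le> ramp_sum g (infdist x A + 1) t"
      using class_L_pos[OF g(1) that(2)] n by (intro ramp_sum_ge) (auto intro: less_imp_le)
    then show ?thesis using g(2)[OF n(2) that] by linarith
  qed
  then show ?thesis unfolding CUAG_def
    by (intro bexI[OF _ ramp_sum_KL[of g, OF g(1)]] bexI[OF _ \<gamma>'] exI[of _ 1]) simp
qed

theorem mainTheorem2:
  fixes U :: "'v::real_normed_vector set"
    and \<U> :: "(real \<Rightarrow> 'v) set"
    and N :: "(real \<Rightarrow> 'v) \<Rightarrow> real"
    and \<phi> :: "real \<Rightarrow> 'x::real_normed_vector \<Rightarrow> (real \<Rightarrow> 'v) \<Rightarrow> 'x"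
    and A :: "'x set"
  assumes "control_system U \<U> N \<phi>"
    and "A \<noteq> {}"
    and "bounded A"
  shows "CUAG \<U> N \<phi> A \<longleftrightarrow> BRS \<U> N \<phi> \<and> UAG \<U> N \<phi> A"
proof -
  have N: "N u \<ge> 0" if "u \<in> \<U>" for u
    using control_system.norm_inputs[OF assms(1)] that by (simp add: norm_on_inputs_def)
  show ?thesis
  proof (intro iffI conjI)
    assume "CUAG \<U> N \<phi> A"
    with N assms(2,3) show "BRS \<U> N \<phi>" by (rule CUAG_imp_BRS)
  next
    assume "CUAG \<U> N \<phi> A"
    then show "UAG \<U> N \<phi> A" by (rule CUAG_imp_UAG)
  next
    assume "BRS \<U> N \<phi> \<and> UAG \<U> N \<phi> A"
    then show "CUAG \<U> N \<phi> A"
      using N assms(2,3) by (intro BRS_UAG_imp_CUAG) auto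
  qed
qed

end
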